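(* Let $m,n\ge 1$. There is a natural bijection between the set $\mathfrak{S}_n^{(m)}(312)$ of $312$-avoiding $m$-Stirling permutations of size $n$ and the set $\mathfrak{A}_n^m$ of admissible $m$-tuples of Dyck paths of size $n$.
   Context: **Stirling permutations.** An $m$-Stirling permutation of size $n$ is a permutation $\pi=(\pi_1,\ldots,\pi_{mn})$ of the multiset $\{1^m,\ldots,n^m\}$ such that every letter $j\neq i$ appearing between two $i$'s satisfies $j>i$. Their set is $\mathfrak{S}_n^{(m)}$. $\mathfrak{S}_n^{(m)}(312)$ is the subset of those $\pi$ having no positions $i<j<k$ with $\pi_j<\pi_k<\pi_i$. **Dyck paths, step sequences and Young order.** A Dyck path of size $n$ is a lattice path with unit steps $N=(0,1)$, $E=(1,0)$ from $(0,0)$ to $(n,n)$ staying weakly above $y=x$. The step sequence of a Dyck path $q$ of size $n$ is $\mathfrak{u}(q)=(u_1,\ldots,u_n)$, where $u_k$ is the number of $E$ steps before the $k$-th $N$ step. $q\le_Y q'$ means $\mathfrak{u}(q')\le\mathfrak{u}(q)$ entrywise. $\mathfrak{A'}_n^m$ is the set of $m$-tuples $(a_1,\ldots,a_m)$ of Dyck paths of size $n$ with $a_m\le_Y a_{m-1}\le_Y\cdots\le_Y a_1$. Let $\mathfrak{U}_n^m$ be the set of weakly increasing integer sequences $(u_1,\ldots,u_n)$ with $0\le u_k\le m(k-1)$ (the step sequences of lattice paths from $(0,0)$ to $(mn,n)$ staying weakly above $y=x/m$). **Map $\beta$.** $\beta:\mathfrak{A'}_n^m\to\mathfrak{U}_n^m$,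 $\beta(a_1,\ldots,a_m)=\sum_{j=1}^m\mathfrak{u}(a_j)$. **Map $\gamma$.** Given $\mathfrak{u}=(u_1,\ldots,u_n)$ and $b\ge1$, define $\mathfrak{l}=(\mathfrak{l}_1,\ldots,\mathfrak{l}_n)$: if $i=n$ or $u_i\ne u_{i+1}$, put $\mathfrak{l}_i=u_i$; if $u_i=u_{i+1}$, let $k$ be the unique index $>i$ such that $u_j-u_i\le b(j-i-1)$ for all $j\in[i+1,k]$ and either $k=n$ or $u_{k+1}-u_i>b(k-i)$, and put $\mathfrak{l}_i=u_i+b(k-i)$. Let $\mathfrak{u}'_b=(u'_1,\ldots,u'_n)$ with $u'_i=\#\{j<i:\mathfrak{l}_j<\mathfrak{l}_i\}$. For $\mathfrak{u}\in\mathfrak{U}_n^m$: start with $b=m$ and $\mathfrak{u}$; compute $\mathfrak{u}'_b$; replace $\mathfrak{u}$ by $\mathfrak{u}-\mathfrak{u}'_b$ and $b$ by $b-1$; repeat until $\mathfrak{u}'_1$ has been computed. Then $\gamma(\mathfrak{u})$ is the $m$-tuple of Dyck paths whose step sequences are $\mathfrak{u}'_1,\ldots,\mathfrak{u}'_m$. **Admissibility.** $\mathfrak{a}\in\mathfrak{A'}_n^m$ is admissible if $\mathfrak{a}=\gamma(\beta(\mathfrak{a}))$; $\mathfrak{A}_n^m$ is the set of admissible elements of $\mathfrak{A'}_n^m$. *)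

theory Defs
  imports Complex_Main "HOL-Combinatorics.Multiset_Permutations"
begin

text \<open>
  Sequences and tuples are lists, so all positions are shifted by one: the mathematical
  \<open>u\<^sub>k\<close> with \<open>1 \<le> k \<le> n\<close> is \<open>u ! (k - 1)\<close>.  The letters of a Stirling permutation are not
  shifted, they range over \<open>{1..n}\<close>.
\<close>

definition stirling_perms :: "nat \<Rightarrow> nat \<Rightarrow> nat list set" where
  "stirling_perms m n =
     {\<pi> \<in> permutations_of_multiset (\<Sum>i\<in>{1..n}. replicate_mset m i).
        \<forall>p q r. p < q \<and> q < r \<and> r < length \<pi> \<and> \<pi> ! p = \<pi> ! r \<and> \<pi> ! q \<noteq> \<pi> ! p
           \<longrightarrow> \<pi> ! p < \<pi> ! q}"

definition avoids_312 :: "nat list \<Rightarrow> bool" where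
  "avoids_312 \<pi> \<longleftrightarrow>
     \<not> (\<exists>i j k. i < j \<and> j < k \<and> k < length \<pi> \<and> \<pi> ! j < \<pi> ! k \<and> \<pi> ! k < \<pi> ! i)"

definition stirling_perms_312 :: "nat \<Rightarrow> nat \<Rightarrow> nat list set" where
  "stirling_perms_312 m n = {\<pi> \<in> stirling_perms m n. avoids_312 \<pi>}"

datatype step = N | E

text \<open>
  After a prefix \<open>p\<close> of the path, the current lattice point is
  \<open>(count_list p E, count_list p N)\<close>.
\<close>

definition dyck_paths :: "nat \<Rightarrow> step list set" where
  "dyck_paths n =
     {q. count_list q N = n \<and> count_list q E = n \<and>
         (\<forall>i \<le> length q. count_list (take i q) E \<le> count_list (take i q) N)}"

definition step_seq :: "step list \<Rightarrow> int list" where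
  "step_seq q =
     map (\<lambda>p. int (count_list (take p q) E)) (filter (\<lambda>p. q ! p = N) [0..<length q])"

definition young_le :: "step list \<Rightarrow> step list \<Rightarrow> bool" where
  "young_le q q' \<longleftrightarrow> list_all2 (\<le>) (step_seq q') (step_seq q)"

definition dyck_chains :: "nat \<Rightarrow> nat \<Rightarrow> step list list set" where
  "dyck_chains m n =
     {a. length a = m \<and> set a \<subseteq> dyck_paths n \<and>
         (\<forall>j. Suc j < m \<longrightarrow> young_le (a ! Suc j) (a ! j))}"

definition beta :: "nat \<Rightarrow> step list list \<Rightarrow> int list" where
  "beta n a = map (\<lambda>k. \<Sum>j<length a. step_seq (a ! j) ! k) [0..<n]"

definition l_seq :: "nat \<Rightarrow> int list \<Rightarrow> int list" where
  "l_seq b u = map (\<lambda>i.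
     if Suc i = length u \<or> u ! i \<noteq> u ! Suc i then u ! i
     else let k = (THE k. i < k \<and> k < length u \<and>
                (\<forall>j\<in>{i+1..k}. u ! j - u ! i \<le> int b * (int j - int i - 1)) \<and>
                (Suc k = length u \<or> u ! Suc k - u ! i > int b * (int k - int i)))
          in u ! i + int b * (int k - int i)) [0..<length u]"

definition u_prime :: "nat \<Rightarrow> int list \<Rightarrow> int list" where
  "u_prime b u =
     map (\<lambda>i. int (card {j. j < i \<and> l_seq b u ! j < l_seq b u ! i})) [0..<length u]"

text \<open>
  The sequences are computed with \<open>b\<close> descending from its initial value to 1, but are listed
  in the order \<open>u'\<^sub>1, \<dots>, u'\<^sub>b\<close>.
\<close>

primrec gamma_seqs :: "nat \<Rightarrow> int list \<Rightarrow> int list list" where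
  "gamma_seqs 0 u = []"
| "gamma_seqs (Suc b) u =
     gamma_seqs b (map2 (-) u (u_prime (Suc b) u)) @ [u_prime (Suc b) u]"

text \<open>
  \<open>gamma\<close> is only meaningful on the weakly increasing sequences \<open>u\<close> of length \<open>n\<close> with
  \<open>0 \<le> u\<^sub>k \<le> m (k - 1)\<close> for \<open>1 \<le> k \<le> n\<close>, which include all values of \<open>beta n\<close> on
  \<open>dyck_chains m n\<close>.
\<close>

definition gamma :: "nat \<Rightarrow> nat \<Rightarrow> int list \<Rightarrow> step list list" where
  "gamma m n u = map (\<lambda>w. THE q. q \<in> dyck_paths n \<and> step_seq q = w) (gamma_seqs m u)"

definition admissible_tuples :: "nat \<Rightarrow> nat \<Rightarrow> step list list set" where
  "admissible_tuples m n = {a \<in> dyck_chains m n. a = gamma m n (beta n a)}"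

end

theory Submission
  imports Defs
begin

text \<open>
  Both sets are in bijection with the set \<open>ballot_seqs m n\<close> of step sequences of lattice paths from
  \<open>(0, 0)\<close> to \<open>(m n, n)\<close> that stay weakly above \<open>y = x / m\<close>, and the bijection of the theorem is the
  composition of the two.

  On the side of Dyck paths, \<open>beta\<close> and \<open>gamma\<close> are inverse to each other. A tuple is admissible when it
  is fixed by \<open>gamma \<circ> beta\<close>, so it suffices that \<open>gamma\<close> maps into the chains and that
  \<open>beta \<circ> gamma\<close> is the identity. Both come from reading \<open>u_prime b u\<close> on the path of \<open>u\<close>: if a
  north step raises the path by \<open>b\<close> and an east step lowers it by one, then each north step \<open>j\<close> is
  followed by a maximal excursion that stays weakly above the height reached, the number
  \<open>l_seq b u ! j\<close> is the abscissa at which this excursion ends, and \<open>u_prime b u ! i\<close> counts the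
  \<open>j < i\<close> whose excursion is over before north step \<open>i\<close>. In the decomposition
  \<open>N P\<^sub>0 E P\<^sub>1 E \<dots> E P\<^sub>b\<close> of a path, this is the number of
  first \<open>E\<close> steps, one for each north step, that precede north step \<open>i\<close>. Subtracting \<open>u_prime b u\<close>
  from \<open>u\<close> deletes these steps, which leaves a path for the slope \<open>b - 1\<close>
  (\<open>diff_u_prime_in_ballot_seqs\<close>). After \<open>m\<close> rounds nothing remains, so the
  sequences of \<open>gamma\<close> add up to \<open>u\<close> (\<open>sum_gamma_seqs\<close>). A deletion merges \<open>P\<^sub>0\<close>
  with \<open>P\<^sub>1\<close>, so excursions only grow and the counts decrease from one round to the
  next (\<open>gamma_seqs_chain\<close>).

  On the side of permutations, the 312-avoiding \<open>m\<close>-Stirling permutations are the outputs of a stack onto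
  which the letters \<open>1, \<dots>, n\<close> are pushed in this order and from which each letter is read \<open>m\<close>
  times before it disappears. A stack run is a lattice path, with pushes as north and reads as east
  steps. A letter is pushed only when it, or a larger one, is about to be read, so the number of reads
  before push \<open>i\<close> is the length of the longest prefix of letters below \<open>i\<close>; these numbers form
  \<open>push_seq\<close>. Its bijectivity is shown by induction on \<open>n\<close>: the copies of the largest letter form a
  block, the letters after the block decrease weakly, the position of the block is the last entry of
  \<open>push_seq\<close>, and the positions allowed for the block are those allowed for this entry
  (\<open>decreasing_suffix_iff\<close>).
\<close>

text \<open>
  The step sequences of lattice paths from \<open>(0, 0)\<close> to \<open>(m n, n)\<close> weakly above \<open>y = x / m\<close>; those of
  Dyck paths are the case \<open>m = 1\<close>.
\<close>
definition ballot_seqs :: "nat \<Rightarrow> nat \<Rightarrow> int list set" where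
  "ballot_seqs m n =
     {u. length u = n \<and> sorted u \<and> (\<forall>k<n. 0 \<le> u ! k \<and> u ! k \<le> int m * int k)}"

section \<open>Excursions and one round of the map gamma\<close>

text \<open>
  North step \<open>i\<close> belongs to the excursion that starts right after north step \<open>j\<close>: up to \<open>i\<close>, the path
  does not fall below the line of slope \<open>1 / b\<close> through the end point of step \<open>j\<close>. The inequality is
  the one that bounds the index \<open>k\<close> in the definition of \<open>l_seq\<close>.
\<close>
definition under :: "nat \<Rightarrow> int list \<Rightarrow> nat \<Rightarrow> nat \<Rightarrow> bool" where
  "under b u j i \<longleftrightarrow> (\<forall>t. j < t \<and> t \<le> i \<longrightarrow> u ! t - u ! j \<le> int b * (int t - int j - 1))"

lemma under_mono: "under b u j i \<Longrightarrow> i' \<le> i \<Longrightarrow> under b u j i'"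
  by (auto simp: under_def)

lemma underD: "under b u j i \<Longrightarrow> j < t \<Longrightarrow> t \<le> i \<Longrightarrow> u ! t - u ! j \<le> int b * (int t - int j - 1)"
  by (simp add: under_def)

lemma under_trans:
  assumes "under b u j i" "under b u i t" "j < i"
  shows "under b u j t"
  unfolding under_def
proof (intro allI impI)
  fix s assume s: "j < s \<and> s \<le> t"
  show "u ! s - u ! j \<le> int b * (int s - int j - 1)"
  proof (cases "s \<le> i")
    case True
    then show ?thesis using assms(1) s by (auto simp: under_def)
  next
    case False
    then have "u ! s - u ! i \<le> int b * (int s - int i - 1)"
      using assms(2) s by (auto simp: under_def)
    moreover have "u ! i - u ! j \<le> int b * (int i - int j - 1)"
      using assms(1,3) by (auto simp: under_def)
    ultimately show ?thesis by (simp add: algebra_simps)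
  qed
qed

text \<open>
  An excursion that reaches \<open>j\<close> also contains the whole excursion after \<open>j\<close>.
\<close>
lemma under_iff_of_under:
  assumes "l < j" "j < i" "under b u j i"
  shows "under b u l i \<longleftrightarrow> under b u l j"
  using assms by (meson less_imp_le_nat under_mono under_trans)

text \<open>
  The two branches in the definition of \<open>l_seq\<close> agree: with \<open>k\<close> the last north step of the excursion
  after \<open>i\<close>, the case \<open>u ! i \<noteq> u ! Suc i\<close> is that of an empty excursion, \<open>k = i\<close>.
\<close>
lemma l_seq_nth:
  assumes "sorted u" "i < length u"
  obtains k where "i \<le> k" "k < length u" "under b u i k"
    "Suc k = length u \<or> u ! Suc k - u ! i > int b * (int k - int i)"
    "l_seq b u ! i = u ! i + int b * (int k - int i)"
proof -
  define P where "P = (\<lambda>k. i \<le> k \<and> k < length u \<and> under b u i k)"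
  have "P i" using assms by (auto simp: P_def under_def)
  moreover have "\<forall>k. P k \<longrightarrow> k \<le> length u" by (auto simp: P_def)
  ultimately obtain k where k: "P k" and max: "\<And>k'. P k' \<Longrightarrow> k' \<le> k"
    using Nat.ex_has_greatest_nat[of P i "length u"] by blast
  have k': "i \<le> k" "k < length u" "under b u i k" using k by (auto simp: P_def)
  have stop: "Suc k = length u \<or> u ! Suc k - u ! i > int b * (int k - int i)"
  proof (rule ccontr)
    assume neg: "\<not> ?thesis"
    have "under b u i (Suc k)"
      using k' neg by (auto simp: under_def le_Suc_eq not_less)
    then have "P (Suc k)" using neg k' by (auto simp: P_def)
    then show False using max[of "Suc k"] by simp
  qed
  have "l_seq b u ! i = u ! i + int b * (int k - int i)"
  proof (cases "Suc i = length u \<or> u ! i \<noteq> u ! Suc i")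
    case True
    have "k = i"
    proof (rule ccontr)
      assume "k \<noteq> i"
      then have "i < k" using k' by simp
      then have "under b u i (Suc i)" using k'(3) under_mono[of b u i k "Suc i"] by simp
      then have "u ! Suc i - u ! i \<le> 0" using underD[of b u i "Suc i" "Suc i"] by simp
      moreover have "u ! i \<le> u ! Suc i"
        using assms(1) \<open>i < k\<close> k'(2) by (intro sorted_nth_mono) auto
      ultimately show False using True \<open>i < k\<close> k'(2) by auto
    qed
    then show ?thesis using True assms(2) by (simp add: l_seq_def)
  next
    case False
    define Q where "Q = (\<lambda>k. i < k \<and> k < length u \<and>
                (\<forall>j\<in>{i+1..k}. u ! j - u ! i \<le> int b * (int j - int i - 1)) \<and>
                (Suc k = length u \<or> u ! Suc k - u ! i > int b * (int k - int i)))"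
    have "P (Suc i)" using False assms(2) by (auto simp: P_def under_def le_Suc_eq)
    then have "i < k" using max[of "Suc i"] by simp
    then have Qk: "Q k" using k' stop by (auto simp: Q_def under_def)
    have uniq: "k' = k" if "Q k'" for k'
    proof -
      have "P k'" using that by (auto simp: P_def Q_def under_def)
      then have "k' \<le> k" by (rule max)
      moreover have "\<not> k' < k"
      proof
        assume "k' < k"
        then have "u ! Suc k' - u ! i \<le> int b * (int (Suc k') - int i - 1)"
          using that by (intro underD[OF k'(3)]) (auto simp: Q_def)
        then have "\<not> u ! Suc k' - u ! i > int b * (int k' - int i)" by simp
        moreover have "Suc k' \<noteq> length u" using \<open>k' < k\<close> k'(2) by linarith
        ultimately show False using that unfolding Q_def by blast
      qed
      ultimately show ?thesis by simp
    qed
    have "(THE k. Q k) = k" using Qk uniq by (rule the_equality)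
    then show ?thesis
      using False assms(2) by (simp add: l_seq_def Q_def)
  qed
  then show thesis using that k' stop by blast
qed

text \<open>
  If \<open>i\<close> lies in the excursion after \<open>j\<close>, its own excursion is nested in it and ends no later.
  Otherwise the excursion after \<open>j\<close> is closed by an east step before north step \<open>i\<close>, and this east step
  makes the inequality strict.
\<close>
lemma l_seq_less_iff:
  assumes "sorted u" "1 \<le> b" "j < i" "i < length u"
  shows "l_seq b u ! j < l_seq b u ! i \<longleftrightarrow> \<not> under b u j i"
proof -
  obtain k where k: "j \<le> k" "k < length u" "under b u j k"
    "Suc k = length u \<or> u ! Suc k - u ! j > int b * (int k - int j)"
    "l_seq b u ! j = u ! j + int b * (int k - int j)"
    using l_seq_nth[of u j b] assms by auto
  obtain k' where k': "i \<le> k'" "k' < length u" "under b u i k'"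
    "Suc k' = length u \<or> u ! Suc k' - u ! i > int b * (int k' - int i)"
    "l_seq b u ! i = u ! i + int b * (int k' - int i)"
    using l_seq_nth[of u i b] assms by auto
  show ?thesis
  proof (cases "under b u j i")
    case True
    then have "under b u j k'" using k'(3) assms(3) by (rule under_trans)
    have "k' \<le> k"
    proof (rule ccontr)
      assume "\<not> k' \<le> k"
      then have "under b u j (Suc k)" using \<open>under b u j k'\<close> under_mono[of b u j k' "Suc k"] by simp
      then have "u ! Suc k - u ! j \<le> int b * (int (Suc k) - int j - 1)"
        using k(1) by (intro underD[of b u j "Suc k"]) auto
      then have "\<not> u ! Suc k - u ! j > int b * (int k - int j)" by simp
      moreover have "Suc k \<noteq> length u" using k'(2) \<open>\<not> k' \<le> k\<close> by linarith
      ultimately show False using k(4) by blast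
    qed
    then have "int b * int k' \<le> int b * int k" by (simp add: mult_left_mono)
    moreover have "u ! i - u ! j \<le> int b * (int i - int j - 1)"
      using True assms(3) by (auto simp: under_def)
    ultimately have "l_seq b u ! i \<le> l_seq b u ! j"
      using k(5) k'(5) by (simp add: algebra_simps)
    then show ?thesis using True by simp
  next
    case False
    then have "k < i" using k(3) under_mono not_less by blast
    then have "l_seq b u ! j < u ! Suc k" using k(4,5) assms(4) by auto
    also have "\<dots> \<le> u ! i" using assms \<open>k < i\<close> by (intro sorted_nth_mono) auto
    also have "\<dots> \<le> l_seq b u ! i" using k'(1,5) by simp
    finally show ?thesis using False by simp
  qed
qed

lemma length_u_prime [simp]: "length (u_prime b u) = length u"
  by (simp add: u_prime_def)

lemma u_prime_nth:
  assumes "sorted u" "1 \<le> b" "i < length u"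
  shows "u_prime b u ! i = int (card {j. j < i \<and> \<not> under b u j i})"
proof -
  have "{j. j < i \<and> l_seq b u ! j < l_seq b u ! i} = {j. j < i \<and> \<not> under b u j i}"
    using l_seq_less_iff[OF assms(1,2) _ assms(3)] by auto
  then show ?thesis using assms(3) by (simp add: u_prime_def)
qed

lemma u_prime_nth_complement:
  assumes "sorted u" "1 \<le> b" "i < length u"
  shows "u_prime b u ! i = int i - int (card {j. j < i \<and> under b u j i})"
proof -
  have "{j. j < i \<and> \<not> under b u j i} = {..<i} - {j. j < i \<and> under b u j i}" by auto
  moreover have "card \<dots> = i - card {j. j < i \<and> under b u j i}"
    by (subst card_Diff_subset) auto
  moreover have "card {j. j < i \<and> under b u j i} \<le> card {..<i}"
    by (rule card_mono) auto
  ultimately show ?thesis using u_prime_nth[OF assms] by (simp add: of_nat_diff)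
qed

text \<open>
  The \<open>l\<close> counted here form a chain of nested excursions from \<open>j\<close> down to \<open>i\<close>. Each link of
  the chain gives an inequality of the form \<open>u ! l' - u ! l \<le> b (l' - l - 1)\<close>; in their sum, every
  intermediate \<open>l\<close> saves a further \<open>b\<close>. The induction splits off the first link.
\<close>
lemma card_under_between:
  assumes "under b u j i" "j < i"
  shows "int b * int (card {l. j < l \<and> l < i \<and> under b u l i}) + (u ! i - u ! j)
           \<le> int b * (int i - int j - 1)"
  using assms
proof (induction "i - j" arbitrary: j rule: less_induct)
  case less
  let ?S = "\<lambda>j. {l. j < l \<and> l < i \<and> under b u l i}"
  show ?case
  proof (cases "?S j = {}")
    case True
    moreover have "u ! i - u ! j \<le> int b * (int i - int j - 1)"
      using less.prems by (auto simp: under_def)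
    ultimately show ?thesis by (simp only: card.empty)
  next
    case False
    define l where "l = Min (?S j)"
    have l: "l \<in> ?S j" unfolding l_def using False by (intro Min_in) auto
    have least: "l \<le> l'" if "l' \<in> ?S j" for l'
      unfolding l_def using that by (intro Min_le) auto
    have "?S j = insert l (?S l)" using l least by (force simp: le_less)
    moreover have "card (insert l (?S l)) = Suc (card (?S l))"
      by (subst card_insert_disjoint) auto
    ultimately have card: "card (?S j) = Suc (card (?S l))" by simp
    have "int b * int (card (?S l)) + (u ! i - u ! l) \<le> int b * (int i - int l - 1)"
      using l less.prems by (intro less.hyps) auto
    moreover have "u ! l - u ! j \<le> int b * (int l - int j - 1)"
      using less.prems l by (auto simp: under_def)
    ultimately show ?thesis using card by (simp add: algebra_simps)
  qed
qed

text \<open>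
  The same estimate for all excursions around \<open>i\<close>. The chain now starts at the origin of the path, and
  the bound on \<open>u\<close> plays the part of its first link.
\<close>
lemma card_under_le:
  assumes "\<forall>k\<le>i. u ! k \<le> int b * int k"
  shows "int b * int (card {l. l < i \<and> under b u l i}) + u ! i \<le> int b * int i"
proof (cases "{l. l < i \<and> under b u l i} = {}")
  case True
  then show ?thesis using assms by (simp only: card.empty) simp
next
  case False
  let ?S = "{l. l < i \<and> under b u l i}"
  define l where "l = Min ?S"
  have l: "l \<in> ?S" unfolding l_def using False by (intro Min_in) auto
  have least: "l \<le> l'" if "l' \<in> ?S" for l'
    unfolding l_def using that by (intro Min_le) auto
  let ?T = "{l'. l < l' \<and> l' < i \<and> under b u l' i}"
  have "?S = insert l ?T" using l least by (force simp: le_less)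
  moreover have "card (insert l ?T) = Suc (card ?T)"
    by (subst card_insert_disjoint) auto
  ultimately have card: "card ?S = Suc (card ?T)" by simp
  have "int b * int (card ?T) + (u ! i - u ! l) \<le> int b * (int i - int l - 1)"
    using l by (intro card_under_between) auto
  moreover have "u ! l \<le> int b * int l" using assms l by simp
  ultimately show ?thesis using card by (simp add: algebra_simps)
qed

text \<open>
  The excursions that end between north steps \<open>i\<close> and \<open>Suc i\<close> are closed by east steps between these
  two, and distinct nested excursions are closed at distinct heights, hence by distinct east steps. So
  there are at most \<open>u ! Suc i - u ! i\<close> of them. The upper bound makes \<open>u - u_prime b u\<close> weakly
  increasing.
\<close>
lemma u_prime_Suc_diff_le:
  assumes "sorted u" "1 \<le> b" "Suc i < length u"
  shows "u_prime b u ! Suc i - u_prime b u ! i \<in> {0..u ! Suc i - u ! i}"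
proof -
  let ?A = "{j. j < i \<and> \<not> under b u j i}"
  let ?B = "{j. j < Suc i \<and> \<not> under b u j (Suc i)}"
  let ?D = "{j. j \<le> i \<and> under b u j i \<and> \<not> under b u j (Suc i)}"
  let ?l = "\<lambda>j. u ! j + int b * (int i - int j)"
  have refl: "under b u i i" by (simp add: under_def)
  have "?B = ?A \<union> ?D" using refl
    by (auto simp: less_Suc_eq_le le_less dest: under_mono[of b u _ "Suc i" i])
  moreover have "card (?A \<union> ?D) = card ?A + card ?D"
    by (rule card_Un_disjoint) auto
  ultimately have diff: "u_prime b u ! Suc i - u_prime b u ! i = int (card ?D)"
    using u_prime_nth[OF assms(1,2,3)] u_prime_nth[OF assms(1,2), of i] assms(3) by simp
  \<comment> \<open>\<open>?l j\<close> is the abscissa at which the excursion after \<open>j\<close> ends.\<close>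
  have less: "?l j' < ?l j" if "j \<in> ?D" "j' \<in> ?D" "j < j'" for j j'
  proof -
    have "u ! j' - u ! j \<le> int b * (int j' - int j - 1)"
      using that by (auto simp: under_def)
    then show ?thesis using assms(2) by (simp add: algebra_simps)
  qed
  have inj: "inj_on ?l ?D"
  proof (rule inj_onI)
    fix j j' assume "j \<in> ?D" "j' \<in> ?D" "?l j = ?l j'"
    then show "j = j'" using less[of j j'] less[of j' j] by (cases j j' rule: linorder_cases) auto
  qed
  have "?l ` ?D \<subseteq> {u ! i..<u ! Suc i}"
  proof (rule image_subsetI)
    fix j assume j: "j \<in> ?D"
    have "u ! Suc i - u ! j > int b * (int i - int j)"
    proof (rule ccontr)
      assume "\<not> ?thesis"
      then have "under b u j (Suc i)" using j by (auto simp: under_def le_Suc_eq not_less)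
      then show False using j by simp
    qed
    moreover have "u ! i \<le> ?l j"
    proof (cases "j = i")
      case False
      then have "u ! i - u ! j \<le> int b * (int i - int j - 1)" using j by (auto simp: under_def)
      then show ?thesis using assms(2) by (simp add: algebra_simps)
    qed simp
    ultimately show "?l j \<in> {u ! i..<u ! Suc i}" by simp
  qed
  then have "card ?D \<le> card {u ! i..<u ! Suc i}"
    using inj by (intro card_inj_on_le) auto
  moreover have "u ! i \<le> u ! Suc i" using assms by (intro sorted_nth_mono) auto
  ultimately show ?thesis using diff by simp
qed

lemma u_prime_0: "u \<noteq> [] \<Longrightarrow> u_prime b u ! 0 = 0"
  by (simp add: u_prime_def)

lemma u_prime_in_ballot_seqs:
  assumes "sorted u" "1 \<le> b"
  shows "u_prime b u \<in> ballot_seqs 1 (length u)"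
proof -
  have "u_prime b u ! k \<le> int k" "0 \<le> u_prime b u ! k" if "k < length u" for k
    using u_prime_nth[OF assms that] u_prime_nth_complement[OF assms that] by auto
  moreover have "sorted (u_prime b u)"
    unfolding sorted_iff_nth_Suc using u_prime_Suc_diff_le[OF assms] by fastforce
  ultimately show ?thesis by (simp add: ballot_seqs_def)
qed

text \<open>
  By \<open>card_under_le\<close>, with \<open>c\<close> excursions around \<open>k\<close> the entry \<open>u ! k\<close> is at most
  \<open>(b + 1) (k - c)\<close>, of which \<open>u_prime\<close> takes away exactly \<open>k - c\<close>.
\<close>
lemma diff_u_prime_in_ballot_seqs:
  assumes "u \<in> ballot_seqs (Suc b) n"
  shows "map2 (-) u (u_prime (Suc b) u) \<in> ballot_seqs b n"
proof -
  let ?v = "map2 (-) u (u_prime (Suc b) u)"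
  have u: "length u = n" "sorted u" "\<And>k. k < n \<Longrightarrow> 0 \<le> u ! k \<and> u ! k \<le> int (Suc b) * int k"
    using assms by (auto simp: ballot_seqs_def)
  have v: "?v ! k = u ! k - u_prime (Suc b) u ! k" if "k < n" for k
    using that u(1) by simp
  have sorted: "sorted ?v"
    unfolding sorted_iff_nth_Suc using u_prime_Suc_diff_le[OF u(2), of "Suc b"] v u(1) by fastforce
  have upper: "?v ! k \<le> int b * int k" if "k < n" for k
  proof -
    let ?c = "int (card {l. l < k \<and> under (Suc b) u l k})"
    have "int (Suc b) * ?c + u ! k \<le> int (Suc b) * int k"
      using u(3) that by (intro card_under_le) auto
    moreover have "int (Suc b) * ?c = int b * ?c + ?c" "int (Suc b) * int k = int b * int k + int k"
      by (simp_all add: algebra_simps)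
    moreover have "0 \<le> int b * ?c" by simp
    moreover have "u_prime (Suc b) u ! k = int k - ?c"
      using u that by (intro u_prime_nth_complement) auto
    ultimately show ?thesis unfolding v[OF that] by linarith
  qed
  have lower: "0 \<le> ?v ! k" if "k < n" for k
  proof -
    have "?v ! 0 = u ! 0" using v[of 0] u(1) u_prime_0[of u] that by (cases "u = []") auto
    then have "0 \<le> ?v ! 0" using u(3)[of 0] that by simp
    also have "?v ! 0 \<le> ?v ! k" using sorted that u(1) by (intro sorted_nth_mono) auto
    finally show ?thesis .
  qed
  show ?thesis using sorted upper lower u(1) by (auto simp: ballot_seqs_def simp del: nth_map nth_zip)
qed

text \<open>
  Deleting the east steps that close excursions can only prolong an excursion: \<open>P\<^sub>0\<close> is
  continued by \<open>P\<^sub>1\<close>.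
\<close>
lemma under_diff_u_prime:
  assumes "sorted u" "under (Suc b) u j i" "i < length u"
  shows "under b (map2 (-) u (u_prime (Suc b) u)) j i"
  unfolding under_def
proof (intro allI impI)
  let ?v = "map2 (-) u (u_prime (Suc b) u)"
  fix t assume t: "j < t \<and> t \<le> i"
  then have jt: "under (Suc b) u j t" using assms(2) under_mono by blast
  let ?C = "\<lambda>i. {l. l < i \<and> under (Suc b) u l i}"
  let ?M = "{l. j < l \<and> l < t \<and> under (Suc b) u l t}"
  \<comment> \<open>Before \<open>j\<close>, the excursions around \<open>t\<close> and around \<open>j\<close> are the same, so \<open>u_prime\<close> changes from
    \<open>j\<close> to \<open>t\<close> only through the north steps from \<open>j\<close> on.\<close>
  have "l \<in> ?C t \<longleftrightarrow> l \<in> insert j (?C j \<union> ?M)" for l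
    using jt t under_iff_of_under[of l j t "Suc b" u]
    by (cases l j rule: linorder_cases) auto
  then have "?C t = insert j (?C j \<union> ?M)" by blast
  moreover have "card (insert j (?C j \<union> ?M)) = Suc (card (?C j \<union> ?M))"
    by (subst card_insert_disjoint) auto
  moreover have "card (?C j \<union> ?M) = card (?C j) + card ?M"
    by (rule card_Un_disjoint) auto
  ultimately have card: "card (?C t) = Suc (card (?C j) + card ?M)" by simp
  have vt: "?v ! t - ?v ! j = u ! t - u ! j - (int t - int j) + 1 + int (card ?M)"
    using u_prime_nth_complement[OF assms(1), of "Suc b" t]
      u_prime_nth_complement[OF assms(1), of "Suc b" j] t assms(3) card by simp
  have "int (Suc b) * int (card ?M) + (u ! t - u ! j) \<le> int (Suc b) * (int t - int j - 1)"
    using jt t by (intro card_under_between) auto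
  moreover have "int (Suc b) * int (card ?M) = int b * int (card ?M) + int (card ?M)"
    "int (Suc b) * (int t - int j - 1) = int b * (int t - int j - 1) + (int t - int j - 1)"
    by (simp_all add: algebra_simps)
  moreover have "0 \<le> int b * int (card ?M)" by simp
  ultimately show "?v ! t - ?v ! j \<le> int b * (int t - int j - 1)"
    unfolding vt by linarith
qed

lemma u_prime_next_round_le:
  assumes "u \<in> ballot_seqs (Suc (Suc b)) n"
  shows "list_all2 (\<le>) (u_prime (Suc b) (map2 (-) u (u_prime (Suc (Suc b)) u))) (u_prime (Suc (Suc b)) u)"
proof -
  let ?v = "map2 (-) u (u_prime (Suc (Suc b)) u)"
  have u: "length u = n" "sorted u" using assms by (auto simp: ballot_seqs_def)
  have v: "length ?v = n" "sorted ?v"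
    using diff_u_prime_in_ballot_seqs[OF assms] by (auto simp: ballot_seqs_def)
  have "u_prime (Suc b) ?v ! i \<le> u_prime (Suc (Suc b)) u ! i" if "i < n" for i
  proof -
    have "{j. j < i \<and> \<not> under (Suc b) ?v j i} \<subseteq> {j. j < i \<and> \<not> under (Suc (Suc b)) u j i}"
      using under_diff_u_prime[OF u(2)] that u(1) by auto
    then have "card {j. j < i \<and> \<not> under (Suc b) ?v j i} \<le> card {j. j < i \<and> \<not> under (Suc (Suc b)) u j i}"
      by (intro card_mono) auto
    then show ?thesis
      using u_prime_nth[OF v(2), of "Suc b" i] u_prime_nth[OF u(2), of "Suc (Suc b)" i] that u v by simp
  qed
  then show ?thesis using u(1) v(1) by (simp add: list_all2_conv_all_nth)
qed

section \<open>The sequences computed by gamma\<close>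

lemma length_gamma_seqs [simp]: "length (gamma_seqs m u) = m"
  by (induction m arbitrary: u) auto

lemma gamma_seqs_in_ballot_seqs:
  "u \<in> ballot_seqs m n \<Longrightarrow> set (gamma_seqs m u) \<subseteq> ballot_seqs 1 n"
proof (induction m arbitrary: u)
  case (Suc m)
  have "u_prime (Suc m) u \<in> ballot_seqs 1 n"
    using Suc.prems u_prime_in_ballot_seqs[of u "Suc m"] by (auto simp: ballot_seqs_def)
  then show ?case using Suc.IH[OF diff_u_prime_in_ballot_seqs[OF Suc.prems]] by simp
qed simp

lemma gamma_seqs_chain:
  "u \<in> ballot_seqs m n \<Longrightarrow> Suc j < m
    \<Longrightarrow> list_all2 (\<le>) (gamma_seqs m u ! j) (gamma_seqs m u ! Suc j)"
proof (induction m arbitrary: u)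
  case (Suc m)
  let ?v = "map2 (-) u (u_prime (Suc m) u)"
  show ?case
  proof (cases "Suc j < m")
    case True
    then show ?thesis
      using Suc.IH[OF diff_u_prime_in_ballot_seqs[OF Suc.prems(1)]] by (simp add: nth_append)
  next
    case False
    then have m: "m = Suc j" using Suc.prems by simp
    show ?thesis using u_prime_next_round_le[of u j n] Suc.prems(1) unfolding m
      by (simp add: nth_append)
  qed
qed simp

text \<open>
  What is left after the last round lies in \<open>ballot_seqs 0 n\<close>, whose only element is the zero sequence.
\<close>
lemma sum_gamma_seqs:
  "u \<in> ballot_seqs m n \<Longrightarrow> k < n \<Longrightarrow> (\<Sum>j<m. gamma_seqs m u ! j ! k) = u ! k"
proof (induction m arbitrary: u)
  case 0
  then show ?case by (force simp: ballot_seqs_def)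
next
  case (Suc m)
  let ?v = "map2 (-) u (u_prime (Suc m) u)"
  have "(\<Sum>j<m. gamma_seqs (Suc m) u ! j ! k) = (\<Sum>j<m. gamma_seqs m ?v ! j ! k)"
    by (rule sum.cong) (auto simp: nth_append)
  also have "\<dots> = ?v ! k" using Suc.IH[OF diff_u_prime_in_ballot_seqs] Suc.prems by blast
  also have "\<dots> = u ! k - u_prime (Suc m) u ! k"
    using Suc.prems by (simp add: ballot_seqs_def)
  finally show ?case by (simp add: nth_append)
qed

section \<open>Dyck paths and their step sequences\<close>

lemma step_seq_Nil [simp]: "step_seq [] = []"
  by (simp add: step_seq_def)

lemma step_seq_Cons:
  "step_seq (s # q) = (if s = N then 0 # step_seq q else map (\<lambda>x. x + 1) (step_seq q))"
proof -
  have "[0..<length (s # q)] = 0 # map Suc [0..<length q]"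
    by (simp add: upt_conv_Cons map_Suc_upt del: upt_Suc)
  then show ?thesis
    by (cases s) (auto simp: step_seq_def filter_map o_def)
qed

lemma step_seq_snoc:
  "step_seq (q @ [s]) = (if s = N then step_seq q @ [int (count_list q E)] else step_seq q)"
proof (induction q)
  case (Cons a q)
  then show ?case by (cases a; cases s) (auto simp: step_seq_Cons)
qed (cases s; simp add: step_seq_Cons)

lemma length_step_seq: "length (step_seq q) = count_list q N"
  by (induction q) (auto simp: step_seq_Cons)

lemma step_seq_nonneg_le: "x \<in> set (step_seq q) \<Longrightarrow> 0 \<le> x \<and> x \<le> int (count_list q E)"
  by (induction q rule: rev_induct) (auto simp: step_seq_snoc split: if_splits)

lemma sorted_step_seq: "sorted (step_seq q)"
  by (induction q rule: rev_induct) (auto simp: step_seq_snoc sorted_append dest: step_seq_nonneg_le)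

lemma step_seq_inj:
  "step_seq q = step_seq q' \<Longrightarrow> count_list q E = count_list q' E \<Longrightarrow> q = q'"
proof (induction q arbitrary: q')
  case Nil
  then show ?case
  proof (cases q')
    case (Cons s r)
    then show ?thesis using Nil by (cases s) (auto simp: step_seq_Cons)
  qed simp
next
  case (Cons s q)
  have *: "0 # xs \<noteq> map (\<lambda>x. x + 1) (step_seq p)" for xs p
    using step_seq_nonneg_le[of "-1" p] by force
  have inj: "map (\<lambda>x. x + 1) xs = map (\<lambda>x. x + 1) ys \<longleftrightarrow> xs = ys" for xs ys :: "int list"
    by (rule inj_map_eq_map) (auto simp: inj_def)
  show ?case
  proof (cases q')
    case Nil
    then show ?thesis using Cons.prems by (cases s) (auto simp: step_seq_Cons)
  next
    case (Cons s' r)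
    show ?thesis
      using Cons.prems Cons.IH[of r] * *[symmetric] inj unfolding Cons
      by (cases s; cases s') (auto simp: step_seq_Cons)
  qed
qed

text \<open>
  Without the Dyck condition, the end point \<open>e\<close> of the path is free. This is what the induction needs:
  the part of the path before the last north step ends at the abscissa of this step.
\<close>
lemma step_seq_surj:
  "sorted w \<Longrightarrow> \<forall>x\<in>set w. 0 \<le> x \<and> x \<le> int e
    \<Longrightarrow> \<exists>q. step_seq q = w \<and> count_list q E = e"
proof (induction w arbitrary: e rule: rev_induct)
  case Nil
  have "step_seq (replicate e E) = [] \<and> count_list (replicate e E) E = e"
    by (induction e) (auto simp: step_seq_Cons)
  then show ?case by blast
next
  case (snoc x w)
  have "sorted w" "\<forall>y\<in>set w. 0 \<le> y \<and> y \<le> int (nat x)"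
    using snoc.prems by (auto simp: sorted_append)
  then obtain q where q: "step_seq q = w" "count_list q E = nat x"
    using snoc.IH[of "nat x"] by blast
  have *: "step_seq (q @ [N] @ replicate d E) = w @ [x] \<and>
      count_list (q @ [N] @ replicate d E) E = nat x + d" for d
  proof (induction d)
    case 0
    then show ?case using q snoc.prems by (simp add: step_seq_snoc)
  next
    case (Suc d)
    then show ?case
      using step_seq_snoc[of "q @ [N] @ replicate d E" E]
      by (simp add: replicate_append_same[symmetric] del: replicate_Suc) (simp add: replicate_append_same)
  qed
  show ?case
    using *[of "e - nat x"] snoc.prems by (intro exI[of _ "q @ [N] @ replicate (e - nat x) E"]) auto
qed

text \<open>
  A path can only cross the diagonal by an east step, so it suffices to test the points at which a north
  step begins, and the end point.
\<close>
lemma prefix_condition_iff: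
  "(\<forall>i\<le>length q. count_list (take i q) E \<le> count_list (take i q) N) \<longleftrightarrow>
   (\<forall>k<length (step_seq q). step_seq q ! k \<le> int k) \<and> count_list q E \<le> count_list q N"
proof (induction q rule: rev_induct)
  case (snoc s q)
  have "(\<forall>i\<le>length (q @ [s]). count_list (take i (q @ [s])) E \<le> count_list (take i (q @ [s])) N) \<longleftrightarrow>
    (\<forall>i\<le>length q. count_list (take i q) E \<le> count_list (take i q) N) \<and>
    count_list (q @ [s]) E \<le> count_list (q @ [s]) N"
    by (auto simp: le_Suc_eq)
  then show ?case unfolding snoc.IH
    by (cases s) (auto simp: step_seq_snoc nth_append less_Suc_eq length_step_seq)
qed simp

lemma bij_betw_step_seq: "bij_betw step_seq (dyck_paths n) (ballot_seqs 1 n)"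
proof (rule bij_betw_imageI)
  show "inj_on step_seq (dyck_paths n)"
    by (auto simp: inj_on_def dyck_paths_def intro: step_seq_inj)
  show "step_seq ` dyck_paths n = ballot_seqs 1 n"
  proof (intro equalityI subsetI)
    fix w assume "w \<in> step_seq ` dyck_paths n"
    then obtain q where q: "w = step_seq q" "q \<in> dyck_paths n" by blast
    have "0 \<le> w ! k" if "k < length w" for k
      using step_seq_nonneg_le that unfolding q(1) by (meson nth_mem)
    then show "w \<in> ballot_seqs 1 n"
      using q by (auto simp: dyck_paths_def ballot_seqs_def prefix_condition_iff sorted_step_seq length_step_seq)
  next
    fix w assume w: "w \<in> ballot_seqs 1 n"
    have "0 \<le> w ! k \<and> w ! k \<le> int n" if "k < n" for k
      using w that by (auto simp: ballot_seqs_def intro: order_trans[of _ "int k"])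
    then have "\<forall>x\<in>set w. 0 \<le> x \<and> x \<le> int n"
      using w by (auto simp: ballot_seqs_def in_set_conv_nth)
    then obtain q where "step_seq q = w" "count_list q E = n"
      using step_seq_surj[of w n] w by (auto simp: ballot_seqs_def)
    then show "w \<in> step_seq ` dyck_paths n"
      using w length_step_seq[of q]
      by (auto simp: dyck_paths_def ballot_seqs_def prefix_condition_iff intro!: image_eqI[of _ _ q])
  qed
qed

section \<open>The maps beta and gamma are inverse to each other\<close>

lemma gamma_nth:
  assumes "u \<in> ballot_seqs m n" "j < m"
  shows "gamma m n u ! j \<in> dyck_paths n" "step_seq (gamma m n u ! j) = gamma_seqs m u ! j"
proof -
  let ?w = "gamma_seqs m u ! j"
  have "?w \<in> ballot_seqs 1 n"
    using gamma_seqs_in_ballot_seqs[OF assms(1)] assms(2) nth_mem[of j "gamma_seqs m u"] by (simp add: subset_iff)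
  then have "?w \<in> step_seq ` dyck_paths n"
    by (simp only: bij_betw_imp_surj_on[OF bij_betw_step_seq])
  then obtain q where q: "q \<in> dyck_paths n" "step_seq q = ?w" by (elim imageE) simp
  have "\<exists>!q. q \<in> dyck_paths n \<and> step_seq q = ?w"
  proof (intro ex1I[of _ q] conjI q)
    fix p assume p: "p \<in> dyck_paths n \<and> step_seq p = ?w"
    show "p = q"
      using inj_onD[OF bij_betw_imp_inj_on[OF bij_betw_step_seq[of n]], of p q] p q by simp
  qed
  from theI'[OF this] assms(2)
  show "gamma m n u ! j \<in> dyck_paths n" "step_seq (gamma m n u ! j) = gamma_seqs m u ! j"
    by (simp_all add: gamma_def)
qed

lemma gamma_in_dyck_chains:
  assumes "u \<in> ballot_seqs m n"
  shows "gamma m n u \<in> dyck_chains m n"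
proof -
  have length: "length (gamma m n u) = m" by (simp add: gamma_def)
  have "set (gamma m n u) \<subseteq> dyck_paths n"
    using gamma_nth(1)[OF assms] length by (auto simp: in_set_conv_nth)
  moreover have "young_le (gamma m n u ! Suc j) (gamma m n u ! j)" if "Suc j < m" for j
    using gamma_nth(2)[OF assms] gamma_seqs_chain[OF assms that] that by (simp add: young_le_def)
  ultimately show ?thesis using length by (simp add: dyck_chains_def)
qed

lemma beta_gamma:
  assumes "u \<in> ballot_seqs m n"
  shows "beta n (gamma m n u) = u"
proof (rule nth_equalityI)
  show "length (beta n (gamma m n u)) = length u"
    using assms by (simp add: beta_def ballot_seqs_def)
  fix k assume "k < length (beta n (gamma m n u))"
  then have k: "k < n" by (simp add: beta_def)
  have "length (gamma m n u) = m" by (simp add: gamma_def)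
  then have "beta n (gamma m n u) ! k = (\<Sum>j<m. step_seq (gamma m n u ! j) ! k)"
    using k by (simp add: beta_def)
  also have "\<dots> = (\<Sum>j<m. gamma_seqs m u ! j ! k)"
    using gamma_nth(2)[OF assms] by simp
  also have "\<dots> = u ! k" by (rule sum_gamma_seqs[OF assms k])
  finally show "beta n (gamma m n u) ! k = u ! k" .
qed

lemma beta_in_ballot_seqs:
  assumes "a \<in> dyck_chains m n"
  shows "beta n a \<in> ballot_seqs m n"
proof -
  have len: "length a = m" using assms by (simp add: dyck_chains_def)
  have mem: "step_seq (a ! j) \<in> ballot_seqs 1 n" if "j < m" for j
  proof -
    have "a ! j \<in> dyck_paths n" using assms that len nth_mem[of j a] by (auto simp: dyck_chains_def)
    then show ?thesis using bij_betw_apply[OF bij_betw_step_seq] by blast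
  qed
  have nth: "beta n a ! k = (\<Sum>j<m. step_seq (a ! j) ! k)" if "k < n" for k
    using that by (simp add: beta_def len)
  have "sorted (beta n a)"
  proof (unfold sorted_iff_nth_Suc, intro allI impI)
    fix k assume "Suc k < length (beta n a)"
    then have k: "Suc k < n" by (simp add: beta_def)
    have "step_seq (a ! j) ! k \<le> step_seq (a ! j) ! Suc k" if "j < m" for j
      using mem[OF that] k by (intro sorted_nth_mono) (auto simp: ballot_seqs_def)
    then show "beta n a ! k \<le> beta n a ! Suc k"
      using k by (simp add: nth) (intro sum_mono, simp)
  qed
  moreover have "0 \<le> beta n a ! k" if "k < n" for k
    unfolding nth[OF that] using mem that by (intro sum_nonneg) (auto simp: ballot_seqs_def)
  moreover have "beta n a ! k \<le> int m * int k" if "k < n" for k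
  proof -
    have "(\<Sum>j<m. step_seq (a ! j) ! k) \<le> (\<Sum>j<m. int k)"
      using mem that by (intro sum_mono) (auto simp: ballot_seqs_def)
    then show ?thesis unfolding nth[OF that] by simp
  qed
  ultimately show ?thesis by (simp add: ballot_seqs_def beta_def)
qed

lemma bij_betw_gamma: "bij_betw (gamma m n) (ballot_seqs m n) (admissible_tuples m n)"
proof (rule bij_betw_byWitness[where f' = "beta n"])
  show "gamma m n ` ballot_seqs m n \<subseteq> admissible_tuples m n"
    by (auto simp: admissible_tuples_def gamma_in_dyck_chains beta_gamma)
  show "beta n ` admissible_tuples m n \<subseteq> ballot_seqs m n"
    by (auto simp: admissible_tuples_def beta_in_ballot_seqs)
qed (auto simp: admissible_tuples_def beta_gamma)

section \<open>Inserting and removing a block of equal letters\<close>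

lemma nth_block:
  "(\<alpha> @ replicate m x @ \<delta>) ! p =
     (if p < length \<alpha> then \<alpha> ! p else if p < length \<alpha> + m then x else \<delta> ! (p - length \<alpha> - m))"
  by (auto simp: nth_append)

text \<open>
  The position that a letter takes after a block of length \<open>m\<close> has been inserted at position \<open>a\<close>.
\<close>
definition skip_block :: "nat \<Rightarrow> nat \<Rightarrow> nat \<Rightarrow> nat" where
  "skip_block a m p = (if p < a then p else p + m)"

lemma skip_block_less_iff [simp]: "skip_block a m p < skip_block a m q \<longleftrightarrow> p < q"
  by (auto simp: skip_block_def)

lemma nth_skip_block:
  "(\<alpha> @ replicate m x @ \<delta>) ! skip_block (length \<alpha>) m p = (\<alpha> @ \<delta>) ! p"
  by (auto simp: nth_append skip_block_def)

lemma skip_block_less_length [simp]: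
  "skip_block (length \<alpha>) m p < length (\<alpha> @ replicate m x @ \<delta>) \<longleftrightarrow> p < length (\<alpha> @ \<delta>)"
  by (auto simp: skip_block_def)

lemma skip_block_cases:
  obtains p' where "p = skip_block a m p'" | "a \<le> p" "p < a + m"
proof (cases "a \<le> p \<and> p < a + m")
  case False
  then have "p = skip_block a m (if p < a then p else p - m)" by (auto simp: skip_block_def)
  then show thesis using that by blast
qed (use that in blast)

section \<open>The largest letter of a 312-avoiding Stirling permutation\<close>

definition stirling_ordered :: "nat list \<Rightarrow> bool" where
  "stirling_ordered \<pi> \<longleftrightarrow> (\<forall>p q r. p < q \<and> q < r \<and> r < length \<pi> \<and> \<pi> ! p = \<pi> ! r \<and> \<pi> ! q \<noteq> \<pi> ! p
           \<longrightarrow> \<pi> ! p < \<pi> ! q)"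

lemma stirling_ordered_remove_block:
  assumes "stirling_ordered (\<alpha> @ replicate m x @ \<delta>)"
  shows "stirling_ordered (\<alpha> @ \<delta>)"
  unfolding stirling_ordered_def
proof (intro allI impI)
  let ?s = "skip_block (length \<alpha>) m"
  fix p q r
  assume "p < q \<and> q < r \<and> r < length (\<alpha> @ \<delta>) \<and> (\<alpha> @ \<delta>) ! p = (\<alpha> @ \<delta>) ! r \<and> (\<alpha> @ \<delta>) ! q \<noteq> (\<alpha> @ \<delta>) ! p"
  then show "(\<alpha> @ \<delta>) ! p < (\<alpha> @ \<delta>) ! q"
    using assms[unfolded stirling_ordered_def, rule_format, of "?s p" "?s q" "?s r"]
      skip_block_less_length[of \<alpha> m r x \<delta>]
    unfolding nth_skip_block skip_block_less_iff by blast
qed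

lemma avoids_312_remove_block:
  assumes "avoids_312 (\<alpha> @ replicate m x @ \<delta>)"
  shows "avoids_312 (\<alpha> @ \<delta>)"
  unfolding avoids_312_def
proof
  let ?s = "skip_block (length \<alpha>) m"
  assume "\<exists>i j k. i < j \<and> j < k \<and> k < length (\<alpha> @ \<delta>) \<and> (\<alpha> @ \<delta>) ! j < (\<alpha> @ \<delta>) ! k \<and> (\<alpha> @ \<delta>) ! k < (\<alpha> @ \<delta>) ! i"
  then obtain i j k where "i < j" "j < k" "k < length (\<alpha> @ \<delta>)"
    "(\<alpha> @ \<delta>) ! j < (\<alpha> @ \<delta>) ! k" "(\<alpha> @ \<delta>) ! k < (\<alpha> @ \<delta>) ! i" by blast
  then have "?s i < ?s j \<and> ?s j < ?s k \<and> ?s k < length (\<alpha> @ replicate m x @ \<delta>) \<and>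
    (\<alpha> @ replicate m x @ \<delta>) ! ?s j < (\<alpha> @ replicate m x @ \<delta>) ! ?s k \<and>
    (\<alpha> @ replicate m x @ \<delta>) ! ?s k < (\<alpha> @ replicate m x @ \<delta>) ! ?s i"
    unfolding nth_skip_block skip_block_less_iff skip_block_less_length by blast
  then show False using assms unfolding avoids_312_def by blast
qed

lemma stirling_ordered_insert_block:
  assumes "stirling_ordered (\<alpha> @ \<delta>)" and less: "\<forall>y\<in>set (\<alpha> @ \<delta>). y < x"
  shows "stirling_ordered (\<alpha> @ replicate m x @ \<delta>)"
  unfolding stirling_ordered_def
proof (intro allI impI)
  let ?s = "skip_block (length \<alpha>) m" and ?\<pi> = "\<alpha> @ replicate m x @ \<delta>"
  fix p q r
  assume pqr: "p < q \<and> q < r \<and> r < length ?\<pi> \<and> ?\<pi> ! p = ?\<pi> ! r \<and> ?\<pi> ! q \<noteq> ?\<pi> ! p"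
  have block: "?\<pi> ! t = x" if "length \<alpha> \<le> t" "t < length \<alpha> + m" for t
    using that by (simp add: nth_block)
  have small: "?\<pi> ! ?s t < x" if "?s t < length ?\<pi>" for t
    using that less unfolding nth_skip_block skip_block_less_length by (meson nth_mem)
  show "?\<pi> ! p < ?\<pi> ! q"
  proof (cases p "length \<alpha>" m rule: skip_block_cases)
    case (1 p')
    then have px: "?\<pi> ! p < x" using small[of p'] pqr by auto
    then obtain r' where r': "r = ?s r'"
      using block[of r] pqr by (cases r "length \<alpha>" m rule: skip_block_cases) auto
    show ?thesis
    proof (cases q "length \<alpha>" m rule: skip_block_cases)
      case (1 q')
      then show ?thesis
        using assms(1)[unfolded stirling_ordered_def, rule_format, of p' q' r'] pqr
        unfolding \<open>p = ?s p'\<close> r' 1 nth_skip_block skip_block_less_iff skip_block_less_length by blast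
    next
      case 2
      then show ?thesis using px block by simp
    qed
  next
    case 2
    then have "?\<pi> ! p = x" by (rule block)
    then have "length \<alpha> \<le> r \<and> r < length \<alpha> + m"
      using pqr small by (cases r "length \<alpha>" m rule: skip_block_cases) (metis less_irrefl, simp)
    then have "?\<pi> ! q = x" using 2 pqr by (intro block) auto
    then show ?thesis using pqr \<open>?\<pi> ! p = x\<close> by simp
  qed
qed

text \<open>
  A pattern that uses a letter of the block uses it as its largest letter, so its other two letters
  would be an ascent after the block.
\<close>
lemma avoids_312_insert_block:
  assumes "avoids_312 (\<alpha> @ \<delta>)" and less: "\<forall>y\<in>set (\<alpha> @ \<delta>). y < x" and dec: "sorted_wrt (\<ge>) \<delta>"
  shows "avoids_312 (\<alpha> @ replicate m x @ \<delta>)"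
  unfolding avoids_312_def
proof
  let ?s = "skip_block (length \<alpha>) m" and ?\<pi> = "\<alpha> @ replicate m x @ \<delta>"
  assume "\<exists>i j k. i < j \<and> j < k \<and> k < length ?\<pi> \<and> ?\<pi> ! j < ?\<pi> ! k \<and> ?\<pi> ! k < ?\<pi> ! i"
  then obtain i j k where ijk: "i < j" "j < k" "k < length ?\<pi>" "?\<pi> ! j < ?\<pi> ! k" "?\<pi> ! k < ?\<pi> ! i"
    by blast
  have block: "?\<pi> ! t = x" if "length \<alpha> \<le> t" "t < length \<alpha> + m" for t
    using that by (simp add: nth_block)
  have "y \<le> x" if "y \<in> set ?\<pi>" for y using that less by (auto split: if_splits intro: less_imp_le)
  then have le: "?\<pi> ! t \<le> x" if "t < length ?\<pi>" for t using that nth_mem by blast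
  have "?\<pi> ! k < x" using ijk le[of i] by simp
  then obtain k' where k': "k = ?s k'"
    using block[of k] by (cases k "length \<alpha>" m rule: skip_block_cases) auto
  have "?\<pi> ! j < x" using ijk le[of i] by simp
  then obtain j' where j': "j = ?s j'"
    using block[of j] by (cases j "length \<alpha>" m rule: skip_block_cases) auto
  show False
  proof (cases i "length \<alpha>" m rule: skip_block_cases)
    case (1 i')
    then show False
      using assms(1) ijk unfolding avoids_312_def k' j' 1 nth_skip_block skip_block_less_iff skip_block_less_length by blast
  next
    case 2
    then have "length \<alpha> \<le> j'" using ijk(1) unfolding j' skip_block_def by (auto split: if_splits)
    then have "(\<alpha> @ \<delta>) ! j' \<ge> (\<alpha> @ \<delta>) ! k'"
      using ijk dec unfolding k' j' skip_block_less_iff skip_block_less_length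
      by (auto simp: nth_append sorted_wrt_iff_nth_less)
    then show False using ijk(4) unfolding k' j' nth_skip_block by simp
  qed
qed

lemma stirling_perms_312_alt:
  "\<pi> \<in> stirling_perms_312 m n \<longleftrightarrow>
     mset \<pi> = (\<Sum>i\<in>{1..n}. replicate_mset m i) \<and> stirling_ordered \<pi> \<and> avoids_312 \<pi>"
  by (auto simp: stirling_perms_312_def stirling_perms_def stirling_ordered_def permutations_of_multiset_def)

lemma set_mset_letters: "1 \<le> m \<Longrightarrow> set_mset (\<Sum>i\<in>{1..n}. replicate_mset m i) = {1..n::nat}"
  by (subst set_mset_sum) auto

lemma stirling_perms_312_set: "1 \<le> m \<Longrightarrow> \<pi> \<in> stirling_perms_312 m n \<Longrightarrow> set \<pi> = {1..n}"
  by (metis stirling_perms_312_alt set_mset_letters set_mset_mset)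

lemma stirling_perms_312_length: "\<pi> \<in> stirling_perms_312 m n \<Longrightarrow> length \<pi> = m * n"
  by (subst size_mset[symmetric]) (simp add: stirling_perms_312_alt)

text \<open>
  No letter is larger than \<open>Suc n\<close>, so nothing can separate its copies. An ascent after them would
  complete a pattern 312.
\<close>
lemma stirling_perms_312_SucE:
  assumes "1 \<le> m" "\<pi> \<in> stirling_perms_312 m (Suc n)"
  obtains \<alpha> \<delta> where "\<pi> = \<alpha> @ replicate m (Suc n) @ \<delta>" "\<alpha> @ \<delta> \<in> stirling_perms_312 m n"
    "sorted_wrt (\<ge>) \<delta>"
proof -
  let ?x = "Suc n"
  have \<pi>: "mset \<pi> = (\<Sum>i\<in>{1..n}. replicate_mset m i) + replicate_mset m ?x" "stirling_ordered \<pi>" "avoids_312 \<pi>"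
    using assms(2) by (auto simp: stirling_perms_312_alt add.commute)
  have set: "set \<pi> = {1..?x}" using stirling_perms_312_set[OF assms] .
  define \<alpha> where "\<alpha> = takeWhile (\<lambda>y. y \<noteq> ?x) \<pi>"
  define \<rho> where "\<rho> = dropWhile (\<lambda>y. y \<noteq> ?x) \<pi>"
  define \<beta> where "\<beta> = takeWhile (\<lambda>y. y = ?x) \<rho>"
  define \<delta> where "\<delta> = dropWhile (\<lambda>y. y = ?x) \<rho>"
  have eq: "\<pi> = \<alpha> @ \<beta> @ \<delta>" by (simp add: \<alpha>_def \<rho>_def \<beta>_def \<delta>_def)
  have \<alpha>: "?x \<notin> set \<alpha>" by (auto simp: \<alpha>_def dest: set_takeWhileD)
  have \<beta>: "\<forall>y\<in>set \<beta>. y = ?x" by (auto simp: \<beta>_def dest: set_takeWhileD)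
  have "\<rho> \<noteq> []" using set by (auto simp: \<rho>_def)
  then have "hd \<rho> = ?x" using hd_dropWhile[of "\<lambda>y. y \<noteq> ?x" \<pi>] by (simp add: \<rho>_def)
  then have "\<beta> \<noteq> []" using \<open>\<rho> \<noteq> []\<close> by (cases \<rho>) (auto simp: \<beta>_def)
  have le: "y \<le> ?x" if "y \<in> set \<pi>" for y using that set by auto
  have \<delta>: "?x \<notin> set \<delta>"
  proof
    assume "?x \<in> set \<delta>"
    then obtain r where r: "r < length \<delta>" "\<delta> ! r = ?x" by (auto simp: in_set_conv_nth)
    have "\<delta> \<noteq> []" using r by auto
    then have hd: "\<delta> ! 0 \<noteq> ?x" using hd_dropWhile[of "\<lambda>y. y = ?x" \<rho>] by (simp add: \<delta>_def hd_conv_nth)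
    then have "0 < r" using r by (cases r) auto
    let ?q = "length \<alpha> + length \<beta>"
    have "\<pi> ! length \<alpha> = ?x" "\<pi> ! ?q = \<delta> ! 0" "\<pi> ! (?q + r) = ?x"
      using \<open>\<beta> \<noteq> []\<close> \<beta> r by (auto simp: eq nth_append)
    then have "?x < \<delta> ! 0"
      using \<pi>(2)[unfolded stirling_ordered_def, rule_format, of "length \<alpha>" ?q "?q + r"]
        \<open>\<beta> \<noteq> []\<close> \<open>0 < r\<close> r hd by (simp add: eq)
    moreover have "\<delta> ! 0 \<le> ?x" using le \<open>\<delta> \<noteq> []\<close> by (auto simp: eq)
    ultimately show False by simp
  qed
  have "count (mset \<pi>) ?x = m"
    using set_mset_letters[OF assms(1), of n] by (simp add: \<pi>(1) not_in_iff[symmetric])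
  moreover have rep: "\<beta> = replicate (length \<beta>) ?x" using \<beta> by (simp add: replicate_eqI)
  moreover have "count (mset \<pi>) ?x = count (mset \<beta>) ?x"
    using \<alpha> \<delta> by (simp add: eq count_mset_0_iff count_list_0_iff)
  moreover have "count (mset \<beta>) ?x = length \<beta>"
    by (subst rep) simp
  ultimately have \<beta>_eq: "\<beta> = replicate m ?x" by simp
  note eq = eq[unfolded \<beta>_eq]
  have "mset (\<alpha> @ \<delta>) + replicate_mset m ?x = (\<Sum>i\<in>{1..n}. replicate_mset m i) + replicate_mset m ?x"
    using \<pi>(1) by (simp add: eq ac_simps)
  then have "\<alpha> @ \<delta> \<in> stirling_perms_312 m n"
    using \<pi>(2,3) stirling_ordered_remove_block avoids_312_remove_block
    unfolding stirling_perms_312_alt eq by auto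
  moreover have "sorted_wrt (\<ge>) \<delta>"
    unfolding sorted_wrt_iff_nth_less
  proof (intro allI impI)
    fix j k assume jk: "j < k" "k < length \<delta>"
    show "\<delta> ! k \<le> \<delta> ! j"
    proof (rule ccontr)
      assume "\<not> \<delta> ! k \<le> \<delta> ! j"
      moreover have "\<delta> ! k < ?x"
        using jk \<delta> le[of "\<delta> ! k"] nth_mem[of k \<delta>] by (auto simp: eq le_less simp del: nth_mem)
      moreover have "\<pi> ! length \<alpha> = ?x" "\<pi> ! (length \<alpha> + m + j) = \<delta> ! j" "\<pi> ! (length \<alpha> + m + k) = \<delta> ! k"
        using assms(1) by (auto simp: eq nth_block)
      moreover have "length \<alpha> < length \<alpha> + m + j" "length \<alpha> + m + j < length \<alpha> + m + k"
        "length \<alpha> + m + k < length \<pi>"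
        using jk assms(1) by (auto simp: eq)
      ultimately show False
        using \<pi>(3) unfolding avoids_312_def by (metis not_le)
    qed
  qed
  ultimately show thesis using that eq by blast
qed

lemma stirling_perms_312_SucI:
  assumes "1 \<le> m" "\<alpha> @ \<delta> \<in> stirling_perms_312 m n" "sorted_wrt (\<ge>) \<delta>"
  shows "\<alpha> @ replicate m (Suc n) @ \<delta> \<in> stirling_perms_312 m (Suc n)"
proof -
  have less: "\<forall>y\<in>set (\<alpha> @ \<delta>). y < Suc n" using stirling_perms_312_set[OF assms(1,2)] by auto
  show ?thesis
    using assms(2,3) stirling_ordered_insert_block[OF _ less] avoids_312_insert_block[OF _ less]
    unfolding stirling_perms_312_alt by (auto simp: ac_simps)
qed

section \<open>Stirling permutations as outputs of a stack\<close>

text \<open>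
  The letters that are read from the stack before letter \<open>i\<close> is pushed are those of the longest prefix
  without a letter \<open>\<ge> i\<close>.
\<close>
definition push_seq :: "nat \<Rightarrow> nat list \<Rightarrow> int list" where
  "push_seq n \<pi> = map (\<lambda>i. int (length (takeWhile (\<lambda>x. x < i) \<pi>))) [1..<Suc n]"

lemma stirling_perms_312_0: "stirling_perms_312 m 0 = {[]}"
  by (auto simp: stirling_perms_312_alt stirling_ordered_def avoids_312_def)

text \<open>
  For a letter \<open>i \<le> n\<close>, the prefix might become shorter if all of \<open>\<alpha>\<close> is below \<open>i\<close>, because the new
  block then stops it. But in this case \<open>\<delta>\<close> contains \<open>n\<close> and, being decreasing, starts with it, so the
  prefix stopped at the same place before.
\<close>
lemma push_seq_insert_block:
  assumes "1 \<le> m" "\<alpha> @ \<delta> \<in> stirling_perms_312 m n" "sorted_wrt (\<ge>) \<delta>"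
  shows "push_seq (Suc n) (\<alpha> @ replicate m (Suc n) @ \<delta>) = push_seq n (\<alpha> @ \<delta>) @ [int (length \<alpha>)]"
proof -
  have set: "set (\<alpha> @ \<delta>) = {1..n}" using stirling_perms_312_set[OF assms(1,2)] .
  obtain m' where m': "m = Suc m'" using assms(1) by (cases m) auto
  have old: "length (takeWhile (\<lambda>x. x < i) (\<alpha> @ replicate m (Suc n) @ \<delta>)) =
    length (takeWhile (\<lambda>x. x < i) (\<alpha> @ \<delta>))" if i: "1 \<le> i" "i \<le> n" for i
  proof (cases "\<forall>y\<in>set \<alpha>. y < i")
    case True
    then have "n \<in> set \<delta>" using set i by (metis One_nat_def Un_iff atLeastAtMost_iff dual_order.trans
          leD order_refl set_append)
    then obtain d \<delta>' where \<delta>: "\<delta> = d # \<delta>'" "n \<le> d" using assms(3) by (cases \<delta>) auto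
    then show ?thesis using True i m' by (simp add: takeWhile_append2)
  next
    case False
    then obtain y where "y \<in> set \<alpha>" "\<not> y < i" by blast
    then show ?thesis by (simp add: takeWhile_append1)
  qed
  have new: "takeWhile (\<lambda>x. x < Suc n) (\<alpha> @ replicate m (Suc n) @ \<delta>) = \<alpha>"
  proof -
    have "x < Suc n" if "x \<in> set \<alpha>" for x
      using that set by (metis Un_iff atLeastAtMost_iff less_Suc_eq_le set_append)
    then show ?thesis by (simp add: takeWhile_append2 m')
  qed
  have "push_seq (Suc n) (\<alpha> @ replicate m (Suc n) @ \<delta>) =
      map (\<lambda>i. int (length (takeWhile (\<lambda>x. x < i) (\<alpha> @ replicate m (Suc n) @ \<delta>)))) [1..<Suc n]
        @ [int (length \<alpha>)]"
    using new by (simp add: push_seq_def)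
  also have "map (\<lambda>i. int (length (takeWhile (\<lambda>x. x < i) (\<alpha> @ replicate m (Suc n) @ \<delta>)))) [1..<Suc n]
      = push_seq n (\<alpha> @ \<delta>)"
    unfolding push_seq_def
  proof (rule map_cong[OF refl])
    fix i assume "i \<in> set [1..<Suc n]"
    then have "1 \<le> i" "i \<le> n" by auto
    from old[OF this] show "int (length (takeWhile (\<lambda>x. x < i) (\<alpha> @ replicate m (Suc n) @ \<delta>))) =
      int (length (takeWhile (\<lambda>x. x < i) (\<alpha> @ \<delta>)))" by simp
  qed
  finally show ?thesis .
qed

text \<open>
  The next block may be inserted at position \<open>k\<close> only if the letters from there on decrease weakly. This
  holds from the block of the largest letter \<open>Suc n\<close> on, and fails before it, because a smaller letter
  then precedes the block. So the condition on \<open>k\<close> is the one on consecutive entries of a sequence in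
  \<open>ballot_seqs\<close>.
\<close>
lemma decreasing_suffix_iff:
  assumes "1 \<le> m" "\<pi> \<in> stirling_perms_312 m (Suc n)"
  shows "sorted_wrt (\<ge>) (drop k \<pi>) \<longleftrightarrow> push_seq (Suc n) \<pi> ! n \<le> int k"
proof -
  obtain \<alpha> \<delta> where \<pi>: "\<pi> = \<alpha> @ replicate m (Suc n) @ \<delta>" and mem: "\<alpha> @ \<delta> \<in> stirling_perms_312 m n"
    and dec: "sorted_wrt (\<ge>) \<delta>"
    using stirling_perms_312_SucE[OF assms] .
  have set: "set (\<alpha> @ \<delta>) = {1..n}" using stirling_perms_312_set[OF assms(1) mem] .
  have last: "push_seq (Suc n) \<pi> ! n = int (length \<alpha>)"
    using push_seq_insert_block[OF assms(1) mem dec] by (simp add: \<pi> nth_append push_seq_def)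
  have "\<not> sorted_wrt (\<ge>) (drop k \<pi>)" if "k < length \<alpha>"
  proof
    assume sorted: "sorted_wrt (\<ge>) (drop k \<pi>)"
    have "Suc n \<in> set (drop (Suc k) \<pi>)" using that assms(1) by (simp add: \<pi>)
    moreover have "drop k \<pi> = \<alpha> ! k # drop (Suc k) \<pi>"
      using that by (simp add: \<pi> Cons_nth_drop_Suc[symmetric])
    ultimately have "Suc n \<le> \<alpha> ! k" using sorted by auto
    moreover have "\<alpha> ! k \<in> set (\<alpha> @ \<delta>)" using that by simp
    ultimately show False unfolding set by simp
  qed
  moreover have "sorted_wrt (\<ge>) (drop k \<pi>)" if "length \<alpha> \<le> k"
  proof -
    have "sorted_wrt (\<ge>) (replicate m (Suc n) @ \<delta>)"
    proof -
      have "y \<le> Suc n" if "y \<in> set \<delta>" for y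
        using that set by (metis Un_iff atLeastAtMost_iff le_SucI set_append)
      moreover have "sorted_wrt (\<ge>) (replicate m (Suc n))" for m by (simp add: sorted_wrt_iff_nth_less)
      ultimately show ?thesis using dec unfolding sorted_wrt_append set_replicate_conv_if by simp
    qed
    then have "sorted_wrt (\<ge>) (drop (k - length \<alpha>) (replicate m (Suc n) @ \<delta>))"
      by (rule sorted_wrt_drop)
    then show ?thesis using that by (simp add: \<pi>)
  qed
  ultimately show ?thesis unfolding last by (meson not_le of_nat_le_iff)
qed

lemma snoc_in_ballot_seqs_iff:
  "u @ [x] \<in> ballot_seqs m (Suc n) \<longleftrightarrow>
     u \<in> ballot_seqs m n \<and> 0 \<le> x \<and> x \<le> int m * int n \<and> (0 < n \<longrightarrow> u ! (n - 1) \<le> x)"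
proof -
  have "(\<forall>y\<in>set u. y \<le> x) \<longleftrightarrow> (0 < n \<longrightarrow> u ! (n - 1) \<le> x)" if "length u = n" "sorted u"
  proof (cases n)
    case (Suc k)
    have "u ! j \<le> u ! k" if "j < n" for j
      using \<open>sorted u\<close> \<open>length u = n\<close> that Suc by (intro sorted_nth_mono) auto
    then show ?thesis using \<open>length u = n\<close> Suc by (force simp: in_set_conv_nth)
  qed (use that in auto)
  then show ?thesis
    by (auto simp: ballot_seqs_def sorted_append nth_append less_Suc_eq)
qed

lemma push_seq_in_ballot_seqs:
  assumes "1 \<le> m"
  shows "\<pi> \<in> stirling_perms_312 m n \<Longrightarrow> push_seq n \<pi> \<in> ballot_seqs m n"
proof (induction n arbitrary: \<pi>)
  case 0
  then show ?case by (simp add: push_seq_def ballot_seqs_def)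
next
  case (Suc n)
  obtain \<alpha> \<delta> where \<pi>: "\<pi> = \<alpha> @ replicate m (Suc n) @ \<delta>" and mem: "\<alpha> @ \<delta> \<in> stirling_perms_312 m n"
    and dec: "sorted_wrt (\<ge>) \<delta>"
    using stirling_perms_312_SucE[OF assms Suc.prems] .
  have "length \<alpha> \<le> m * n" using stirling_perms_312_length[OF mem] by simp
  then have "int (length \<alpha>) \<le> int m * int n" by (metis of_nat_le_iff of_nat_mult)
  moreover have "push_seq n (\<alpha> @ \<delta>) ! (n - 1) \<le> int (length \<alpha>)" if "0 < n"
    using decreasing_suffix_iff[OF assms, of "\<alpha> @ \<delta>" "n - 1" "length \<alpha>"] mem dec that by simp
  ultimately show ?case
    unfolding \<pi> push_seq_insert_block[OF assms mem dec] snoc_in_ballot_seqs_iff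
    using Suc.IH[OF mem] by simp
qed

lemma push_seq_inj:
  assumes "1 \<le> m"
  shows "\<pi> \<in> stirling_perms_312 m n \<Longrightarrow> \<pi>' \<in> stirling_perms_312 m n
    \<Longrightarrow> push_seq n \<pi> = push_seq n \<pi>' \<Longrightarrow> \<pi> = \<pi>'"
proof (induction n arbitrary: \<pi> \<pi>')
  case 0
  then show ?case by (simp add: stirling_perms_312_0)
next
  case (Suc n)
  obtain \<alpha> \<delta> where \<pi>: "\<pi> = \<alpha> @ replicate m (Suc n) @ \<delta>" and mem: "\<alpha> @ \<delta> \<in> stirling_perms_312 m n"
    and dec: "sorted_wrt (\<ge>) \<delta>"
    using stirling_perms_312_SucE[OF assms Suc.prems(1)] .
  obtain \<alpha>' \<delta>' where \<pi>': "\<pi>' = \<alpha>' @ replicate m (Suc n) @ \<delta>'"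
    and mem': "\<alpha>' @ \<delta>' \<in> stirling_perms_312 m n" and dec': "sorted_wrt (\<ge>) \<delta>'"
    using stirling_perms_312_SucE[OF assms Suc.prems(2)] .
  have "push_seq n (\<alpha> @ \<delta>) = push_seq n (\<alpha>' @ \<delta>')" "length \<alpha> = length \<alpha>'"
    using Suc.prems(3)
    unfolding \<pi> \<pi>' push_seq_insert_block[OF assms mem dec] push_seq_insert_block[OF assms mem' dec']
    by simp_all
  then show ?case using Suc.IH[OF mem mem'] by (simp add: \<pi> \<pi>')
qed

lemma push_seq_surj:
  assumes "1 \<le> m"
  shows "u \<in> ballot_seqs m n \<Longrightarrow> \<exists>\<pi>\<in>stirling_perms_312 m n. push_seq n \<pi> = u"
proof (induction n arbitrary: u)
  case 0
  then show ?case by (simp add: stirling_perms_312_0 push_seq_def ballot_seqs_def)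
next
  case (Suc n)
  have "u \<noteq> []" using Suc.prems by (auto simp: ballot_seqs_def)
  then obtain u' x where u: "u = u' @ [x]" by (metis rev_exhaust)
  then have u': "u' \<in> ballot_seqs m n" and x: "0 \<le> x" "x \<le> int m * int n" "0 < n \<longrightarrow> u' ! (n - 1) \<le> x"
    using Suc.prems by (simp_all add: snoc_in_ballot_seqs_iff)
  then obtain \<pi> where \<pi>: "\<pi> \<in> stirling_perms_312 m n" "push_seq n \<pi> = u'" using Suc.IH by blast
  let ?\<alpha> = "take (nat x) \<pi>" and ?\<delta> = "drop (nat x) \<pi>"
  have mem: "?\<alpha> @ ?\<delta> \<in> stirling_perms_312 m n" using \<pi> by simp
  have dec: "sorted_wrt (\<ge>) ?\<delta>"
  proof (cases n)
    case 0
    then show ?thesis using \<pi> by (simp add: stirling_perms_312_0)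
  next
    case (Suc k)
    then show ?thesis using decreasing_suffix_iff[OF assms, of \<pi> k "nat x"] \<pi> x by simp
  qed
  have "nat x \<le> length \<pi>" using x stirling_perms_312_length[OF \<pi>(1)] by (simp add: nat_le_iff)
  then have "push_seq (Suc n) (?\<alpha> @ replicate m (Suc n) @ ?\<delta>) = u"
    using push_seq_insert_block[OF assms mem dec] \<pi> x(1) u by simp
  then show ?case using stirling_perms_312_SucI[OF assms mem dec] by blast
qed

lemma bij_betw_push_seq:
  assumes "1 \<le> m"
  shows "bij_betw (push_seq n) (stirling_perms_312 m n) (ballot_seqs m n)"
  unfolding bij_betw_def inj_on_def
  using push_seq_inj[OF assms] push_seq_in_ballot_seqs[OF assms] push_seq_surj[OF assms] by blast

section \<open>The bijection\<close>

theorem theorem4p23: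
  fixes m n :: nat
  assumes "m \<ge> 1" and "n \<ge> 1"
  shows "\<exists>f. bij_betw f (stirling_perms_312 m n) (admissible_tuples m n)"
  using bij_betw_trans[OF bij_betw_push_seq[OF assms(1)] bij_betw_gamma] by blast

end
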